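(* Let $X$ be a zero-dimensional Hausdorff space and let $A_c(X)$ be a ring with $C_c^*(X)\subseteq A_c(X)\subseteq C_c(X)$. Then the structure space $\mathrm{Max}(A_c(X))$ is a (compact Hausdorff) zero-dimensional space. Furthermore, the pair $(\Psi_A,\mathrm{Max}(A_c(X)))$, where $\Psi_A: X\to \mathrm{Max}(A_c(X))$ is given by $\Psi_A(x)=\{f\in A_c(X): f(x)=0\}$, is topologically equivalent (as a compactification of $X$) to the Banaschewski compactification $\beta_0X$. If in addition $X$ is strongly zero-dimensional, meaning that the Stone–Čech compactification $\beta X$ is zero-dimensional, then $(\Psi_A,\mathrm{Max}(A_c(X)))$ is topologically equivalent to $\beta X$.
   Context: A space is zero-dimensional if its clopen sets form a base for its topology. $C(X)$ is the ring of real-valued continuous functions on $X$; $C_c(X)$ is the subring of those $f\in C(X)$ with $f(X)$ countable, and $C_c^*(X)$ is the subring of bounded members of $C_c(X)$. The structure space $\mathrm{Max}(R)$ of a commutative ring $R$ with unity is the set of maximal ideals of $R$ with the hull-kernel topology, for which the sets $\{M\in\mathrm{Max}(R): a\in M\}$, $a\in R$, form a base for the closed sets. A (Hausdorff) compactification of a Tychonoff space $X$ is a pair $(\alpha,\alpha X)$, where $\alpha X$ is a compact Hausdorff space and $\alpha:X\to\alpha X$ is a topological embedding with dense image. For compactifications write $\alpha X\ge\gamma X$ if there is a continuous map $t:\alpha X\to\gamma X$ with $t\circ\alpha=\gamma$; if such a $t$ can be chosen to be a homeomorphism, $\alpha X$ and $\gamma X$ are called topologically equivalent. $\beta_0X$,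 the Banaschewski compactification of a zero-dimensional Hausdorff space $X$, is the largest (with respect to $\ge$) zero-dimensional compactification of $X$. *)

theory Defs
  imports "HOL-Analysis.Analysis" "HOL-Algebra.Ideal" "HOL-Algebra.Subrings"
begin

(* clashes with the topological closure of the same notation *)
no_notation eq_closure_of (\<open>closure'_of\<index>\<close>)

section \<open>Zero-dimensional spaces\<close>

definition zero_dimensional_space :: "'a topology \<Rightarrow> bool" where
  "zero_dimensional_space X \<longleftrightarrow>
     openin X = arbitrary union_of (\<lambda>U. openin X U \<and> closedin X U)"

lemma zero_dimensional_space_alt:
  "zero_dimensional_space X \<longleftrightarrow>
     (\<forall>U x. openin X U \<and> x \<in> U \<longrightarrow> (\<exists>V. openin X V \<and> closedin X V \<and> x \<in> V \<and> V \<subseteq> U))"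
  unfolding zero_dimensional_space_def openin_topology_base_unique by blast

lemma zero_dimensional_space_iff_dim_le_0: "zero_dimensional_space X \<longleftrightarrow> X dim_le 0"
  unfolding zero_dimensional_space_alt dimension_le_0_neighbourhood_base_of_clopen
  by (subst open_neighbourhood_base_of) blast+

section \<open>Rings of continuous functions\<close>

text \<open>Functions on the space \<^term>\<open>X\<close> are represented by functions on the ambient type
  that are \<^const>\<open>undefined\<close> outside \<^term>\<open>topspace X\<close>.\<close>

definition cont_funs :: "'a topology \<Rightarrow> ('a \<Rightarrow> real) set" where
  "cont_funs X = {f \<in> extensional (topspace X). continuous_map X euclideanreal f}"

definition Cc :: "'a topology \<Rightarrow> ('a \<Rightarrow> real) set" where
  "Cc X = {f \<in> cont_funs X. countable (f ` topspace X)}"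

definition Cc_star :: "'a topology \<Rightarrow> ('a \<Rightarrow> real) set" where
  "Cc_star X = {f \<in> Cc X. bounded (f ` topspace X)}"

definition cont_ring :: "'a topology \<Rightarrow> ('a \<Rightarrow> real) ring" where
  "cont_ring X =
     \<lparr>carrier = cont_funs X,
      mult = (\<lambda>f g. \<lambda>x\<in>topspace X. f x * g x),
      one = (\<lambda>x\<in>topspace X. 1),
      zero = (\<lambda>x\<in>topspace X. 0),
      add = (\<lambda>f g. \<lambda>x\<in>topspace X. f x + g x)\<rparr>"

section \<open>The structure space of a commutative ring\<close>

definition max_ideals :: "('a, 'm) ring_scheme \<Rightarrow> 'a set set" where
  "max_ideals R = {M. maximalideal M R}"

text \<open>The hull-kernel topology, given by the base of open sets complementary to the base
  of closed sets formed by the hulls of the single elements; the lemmas below justify this for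
  commutative rings.\<close>

definition structure_space :: "('a, 'm) ring_scheme \<Rightarrow> 'a set topology" where
  "structure_space R =
     topology (arbitrary union_of
       (\<lambda>U. \<exists>a \<in> carrier R. U = max_ideals R - {M \<in> max_ideals R. a \<in> M}))"

lemma openin_structure_space:
  assumes "cring R"
  shows "openin (structure_space R) =
     arbitrary union_of (\<lambda>U. \<exists>a \<in> carrier R. U = max_ideals R - {M \<in> max_ideals R. a \<in> M})"
proof -
  interpret cring R by fact
  have "istopology (arbitrary union_of
     (\<lambda>U. \<exists>a \<in> carrier R. U = max_ideals R - {M \<in> max_ideals R. a \<in> M}))"
  proof (rule istopology_base)
    fix S T
    assume "\<exists>a \<in> carrier R. S = max_ideals R - {M \<in> max_ideals R. a \<in> M}"
      and "\<exists>a \<in> carrier R. T = max_ideals R - {M \<in> max_ideals R. a \<in> M}"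
    then obtain a b where ab: "a \<in> carrier R" "b \<in> carrier R"
      and S: "S = max_ideals R - {M \<in> max_ideals R. a \<in> M}"
      and T: "T = max_ideals R - {M \<in> max_ideals R. b \<in> M}"
      by blast
    have "a \<otimes>\<^bsub>R\<^esub> b \<in> M \<longleftrightarrow> a \<in> M \<or> b \<in> M" if "M \<in> max_ideals R" for M
    proof -
      have M: "maximalideal M R" using that by (simp add: max_ideals_def)
      interpret maximalideal M R by fact
      interpret P: primeideal M R by (rule maximalideal_prime[OF M])
      show ?thesis
        using P.I_prime ab I_l_closed I_r_closed by blast
    qed
    then have "S \<inter> T = max_ideals R - {M \<in> max_ideals R. a \<otimes>\<^bsub>R\<^esub> b \<in> M}"
      unfolding S T by blast
    then show "\<exists>a \<in> carrier R. S \<inter> T = max_ideals R - {M \<in> max_ideals R. a \<in> M}"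
      using ab by blast
  qed
  then show ?thesis
    by (simp add: structure_space_def)
qed

lemma topspace_structure_space:
  assumes "cring R"
  shows "topspace (structure_space R) = max_ideals R"
proof -
  interpret cring R by fact
  let ?P = "\<lambda>U. \<exists>a \<in> carrier R. U = max_ideals R - {M \<in> max_ideals R. a \<in> M}"
  have "\<one>\<^bsub>R\<^esub> \<notin> M" if "M \<in> max_ideals R" for M
  proof -
    interpret maximalideal M R using that by (simp add: max_ideals_def)
    show ?thesis using one_imp_carrier I_notcarr by blast
  qed
  then have "max_ideals R = max_ideals R - {M \<in> max_ideals R. \<one>\<^bsub>R\<^esub> \<in> M}"
    by blast
  then have "?P (max_ideals R)"
    by blast
  then have "openin (structure_space R) (max_ideals R)"
    unfolding openin_structure_space[OF assms] by (rule arbitrary_union_of_inc)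
  moreover have "topspace (structure_space R) \<subseteq> max_ideals R"
  proof -
    have "(arbitrary union_of ?P) (topspace (structure_space R))"
      using openin_topspace unfolding openin_structure_space[OF assms, symmetric] .
    then show ?thesis
      by (auto simp: union_of_def arbitrary_def)
  qed
  ultimately show ?thesis
    by (meson openin_subset subset_antisym)
qed

section \<open>Compactifications\<close>

type_synonym ('a, 'b) compactification = "('a \<Rightarrow> 'b) \<times> 'b topology"

definition is_compactification :: "'a topology \<Rightarrow> ('a, 'b) compactification \<Rightarrow> bool" where
  "is_compactification X = (\<lambda>(\<alpha>, K).
     compact_space K \<and> Hausdorff_space K \<and> embedding_map X K \<alpha> \<and>
     K closure_of (\<alpha> ` topspace X) = topspace K)"

definition compactification_ge ::
  "'a topology \<Rightarrow> ('a, 'b) compactification \<Rightarrow> ('a, 'c) compactification \<Rightarrow> bool" where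
  "compactification_ge X = (\<lambda>(\<alpha>, K) (\<gamma>, L).
     \<exists>t. continuous_map K L t \<and> (\<forall>x \<in> topspace X. t (\<alpha> x) = \<gamma> x))"

definition compactification_equiv ::
  "'a topology \<Rightarrow> ('a, 'b) compactification \<Rightarrow> ('a, 'c) compactification \<Rightarrow> bool" where
  "compactification_equiv X = (\<lambda>(\<alpha>, K) (\<gamma>, L).
     \<exists>t. homeomorphic_map K L t \<and> (\<forall>x \<in> topspace X. t (\<alpha> x) = \<gamma> x))"

text \<open>``Largest'' refers to all compactifications, but HOL cannot quantify over types inside a
  formula. We therefore compare with the compactifications carried by the type
  \<^typ>\<open>'a set set\<close>; every Hausdorff compactification of \<^term>\<open>X\<close> is topologically
  equivalent to one of these (lemma \<open>compactification_small\<close> below).\<close>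

definition is_stone_cech :: "'a topology \<Rightarrow> ('a, 'b) compactification \<Rightarrow> bool" where
  "is_stone_cech X c \<longleftrightarrow> is_compactification X c \<and>
     (\<forall>d :: ('a, 'a set set) compactification.
        is_compactification X d \<longrightarrow> compactification_ge X c d)"

definition is_banaschewski :: "'a topology \<Rightarrow> ('a, 'b) compactification \<Rightarrow> bool" where
  "is_banaschewski X c \<longleftrightarrow> is_compactification X c \<and> zero_dimensional_space (snd c) \<and>
     (\<forall>d :: ('a, 'a set set) compactification.
        is_compactification X d \<and> zero_dimensional_space (snd d) \<longrightarrow> compactification_ge X c d)"

text \<open>These choices are determined up to topological equivalence; existence is lemma
  \<open>is_stone_cech_stone_cech\<close>, respectively \<open>is_banaschewski_banaschewski\<close>.\<close>

definition stone_cech :: "'a topology \<Rightarrow> ('a, 'a set set) compactification" where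
  "stone_cech X = (SOME c. is_stone_cech X c)"

definition banaschewski :: "'a topology \<Rightarrow> ('a, 'a set set) compactification" where
  "banaschewski X = (SOME c. is_banaschewski X c)"

definition strongly_zero_dimensional_space :: "'a topology \<Rightarrow> bool" where
  "strongly_zero_dimensional_space X \<longleftrightarrow> zero_dimensional_space (snd (stone_cech X))"

definition fixed_ideal :: "('a \<Rightarrow> real) set \<Rightarrow> 'a \<Rightarrow> ('a \<Rightarrow> real) set" where
  "fixed_ideal A x = {f \<in> A. f x = 0}"

section \<open>The two largest compactifications exist\<close>

lemma embedding_imp_continuous_map:
  "embedding_map X Y f \<Longrightarrow> continuous_map X Y f"
  unfolding embedding_map_def
  using continuous_map_in_subtopology homeomorphic_imp_continuous_map by blast

lemma embedding_map_image_subset: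
  "embedding_map X Y f \<Longrightarrow> f ` topspace X \<subseteq> topspace Y"
  by (intro continuous_map_image_subset_topspace embedding_imp_continuous_map)

lemma zero_dimensional_space_homeomorphic_map:
  assumes "homeomorphic_map K L h" "zero_dimensional_space K"
  shows "zero_dimensional_space L"
  unfolding zero_dimensional_space_alt
proof (intro allI impI)
  fix U y assume U: "openin L U \<and> y \<in> U"
  then have y: "y \<in> topspace L" using openin_subset by blast
  let ?U' = "{x \<in> topspace K. h x \<in> U}"
  have "openin K ?U'"
    using openin_continuous_map_preimage[OF homeomorphic_imp_continuous_map[OF assms(1)]] U
    by blast
  moreover obtain x where x: "x \<in> topspace K" "h x = y"
    using assms(1) y by (metis homeomorphic_imp_surjective_map imageE)
  ultimately obtain V where V: "openin K V" "closedin K V" "x \<in> V" "V \<subseteq> ?U'"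
    using assms(2) U unfolding zero_dimensional_space_alt by blast
  have "openin L (h ` V)" "closedin L (h ` V)"
    using assms(1) V homeomorphic_map_openness homeomorphic_map_closedness
    by (metis openin_subset)+
  then show "\<exists>V. openin L V \<and> closedin L V \<and> y \<in> V \<and> V \<subseteq> U"
    using V x by (intro exI[of _ "h ` V"]) auto
qed

lemma homeomorphic_map_pullback:
  assumes "inj_on h (topspace K)"
  shows "homeomorphic_map K
    (pullback_topology (h ` topspace K) (inv_into (topspace K) h) K) h"
proof -
  let ?S = "topspace K"
  let ?g = "inv_into ?S h"
  let ?L = "pullback_topology (h ` ?S) ?g K"
  have gh: "\<And>x. x \<in> ?S \<Longrightarrow> ?g (h x) = x" using assms by simp
  have "continuous_map K ?L h"
  proof (rule continuous_map_pullback')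
    show "continuous_map K K (?g \<circ> h)"
      by (rule continuous_map_eq[OF continuous_map_id]) (simp add: gh)
    show "topspace K \<subseteq> h -` (h ` ?S)"
      by blast
  qed
  moreover have "continuous_map ?L K ?g"
    using continuous_map_pullback[OF continuous_map_id[of K], of "h ` ?S" ?g] by simp
  moreover have "\<And>y. y \<in> topspace ?L \<Longrightarrow> h (?g y) = y"
    by (auto simp: topspace_pullback_topology f_inv_into_f)
  ultimately have "homeomorphic_maps K ?L h ?g"
    using gh by (auto simp: homeomorphic_maps_def)
  then show ?thesis
    by (rule homeomorphic_maps_imp_map)
qed

lemma is_compactification_homeomorphic_map:
  assumes "is_compactification X (\<alpha>, K)" "homeomorphic_map K L h"
  shows "is_compactification X (h \<circ> \<alpha>, L)"
proof -
  have c: "compact_space K" "Hausdorff_space K" "embedding_map X K \<alpha>"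
    and d: "K closure_of (\<alpha> ` topspace X) = topspace K"
    using assms(1) by (auto simp: is_compactification_def)
  have KL: "K homeomorphic_space L"
    using assms(2) by (simp add: homeomorphic_map_imp_homeomorphic_space)
  have sub: "\<alpha> ` topspace X \<subseteq> topspace K"
    using c(3) by (rule embedding_map_image_subset)
  have "L closure_of (h ` (\<alpha> ` topspace X)) = h ` (K closure_of (\<alpha> ` topspace X))"
    using homeomorphic_map_closure_of[OF assms(2) sub] .
  also have "\<dots> = topspace L"
    using d assms(2) homeomorphic_imp_surjective_map by metis
  finally show ?thesis
    using c KL homeomorphic_compact_space[OF KL] homeomorphic_Hausdorff_space[OF KL]
      embedding_map_compose[OF c(3) iffD2[OF surjective_embedding_map assms(2), THEN conjunct1]]
    by (simp add: is_compactification_def image_comp)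
qed

lemma compactification_small:
  fixes c :: "('a, 'b) compactification"
  assumes "is_compactification X c"
  obtains d :: "('a, 'a set set) compactification"
  where "is_compactification X d" "compactification_equiv X c d"
    "zero_dimensional_space (snd c) \<Longrightarrow> zero_dimensional_space (snd d)"
proof -
  obtain \<alpha> K where c: "c = (\<alpha>, K)" by fastforce
  define h where
    "h y = {U. \<exists>V. openin K V \<and> y \<in> V \<and> U = {x \<in> topspace X. \<alpha> x \<in> V}}" for y
  have "inj_on h (topspace K)"
  proof (rule inj_onI, rule ccontr)
    fix y z assume yz: "y \<in> topspace K" "z \<in> topspace K" "h y = h z" "y \<noteq> z"
    have "Hausdorff_space K" using assms by (simp add: c is_compactification_def)
    then obtain V W where VW: "openin K V" "openin K W" "y \<in> V" "z \<in> W" "disjnt V W"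
      using yz unfolding Hausdorff_space_def by meson
    have "{x \<in> topspace X. \<alpha> x \<in> V} \<in> h z"
      using VW yz(3) by (auto simp flip: yz(3) simp: h_def)
    then obtain V' where V': "openin K V'" "z \<in> V'"
      "{x \<in> topspace X. \<alpha> x \<in> V} = {x \<in> topspace X. \<alpha> x \<in> V'}"
      by (auto simp: h_def)
    have "z \<in> K closure_of (\<alpha> ` topspace X)"
      using assms yz by (simp add: c is_compactification_def)
    then obtain x where "x \<in> topspace X" "\<alpha> x \<in> V' \<inter> W"
      using openin_Int[OF V'(1) VW(2)] V'(2) VW(4) by (auto simp: in_closure_of)
    then show False
      using V'(3) VW(5) by (auto simp: disjnt_def)
  qed
  then obtain L where L: "homeomorphic_map K L h"
    using homeomorphic_map_pullback by blast
  show ?thesis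
  proof
    show "is_compactification X (h \<circ> \<alpha>, L)"
      using is_compactification_homeomorphic_map assms L c by blast
    show "compactification_equiv X c (h \<circ> \<alpha>, L)"
      using L by (auto simp: c compactification_equiv_def)
    show "zero_dimensional_space (snd (h \<circ> \<alpha>, L))" if "zero_dimensional_space (snd c)"
      using zero_dimensional_space_homeomorphic_map[OF L] that c by simp
  qed
qed

lemma compactification_ge_trans:
  assumes "compactification_ge X c d" "compactification_ge X d e"
  shows "compactification_ge X c e"
proof -
  obtain \<alpha> K \<gamma> L \<delta> M where eq: "c = (\<alpha>, K)" "d = (\<gamma>, L)" "e = (\<delta>, M)"
    by (metis surj_pair)
  obtain s t where "continuous_map K L s" "\<forall>x \<in> topspace X. s (\<alpha> x) = \<gamma> x"
    "continuous_map L M t" "\<forall>x \<in> topspace X. t (\<gamma> x) = \<delta> x"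
    using assms by (auto simp: eq compactification_ge_def)
  then show ?thesis
    unfolding eq compactification_ge_def
    by (auto intro!: exI[of _ "t \<circ> s"] intro: continuous_map_compose)
qed

lemma compactification_equiv_imp_ge:
  "compactification_equiv X c d \<Longrightarrow> compactification_ge X c d"
  by (auto simp: compactification_equiv_def compactification_ge_def
        intro: homeomorphic_imp_continuous_map)

lemma compactification_equiv_sym:
  assumes "compactification_equiv X c d" "is_compactification X c"
  shows "compactification_equiv X d c"
proof -
  obtain \<alpha> K \<gamma> L where eq: "c = (\<alpha>, K)" "d = (\<gamma>, L)" by fastforce
  obtain t where t: "homeomorphic_map K L t" "\<forall>x \<in> topspace X. t (\<alpha> x) = \<gamma> x"
    using assms(1) by (auto simp: eq compactification_equiv_def)
  then obtain s where s: "homeomorphic_maps K L t s"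
    using homeomorphic_map_maps by blast
  have "embedding_map X K \<alpha>"
    using assms(2) by (simp add: eq is_compactification_def)
  then have "\<And>x. x \<in> topspace X \<Longrightarrow> \<alpha> x \<in> topspace K"
    using embedding_map_image_subset by blast
  then have "\<forall>x \<in> topspace X. s (\<gamma> x) = \<alpha> x"
    using s t by (metis homeomorphic_maps_def)
  moreover have "homeomorphic_map L K s"
    using s by (meson homeomorphic_maps_sym homeomorphic_maps_imp_map)
  ultimately show ?thesis
    by (auto simp: eq compactification_equiv_def)
qed

theorem is_stone_cech_ge:
  assumes "is_stone_cech X c" "is_compactification X d"
  shows "compactification_ge X c d"
proof -
  obtain d' :: "('a, 'a set set) compactification"
    where "is_compactification X d'" "compactification_equiv X d d'"
    using compactification_small[OF assms(2)] by blast
  then have "compactification_ge X c d'" "compactification_ge X d' d"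
    using assms compactification_equiv_imp_ge[OF compactification_equiv_sym, of X d d']
    unfolding is_stone_cech_def by blast+
  then show ?thesis
    by (rule compactification_ge_trans)
qed

theorem is_banaschewski_ge:
  assumes "is_banaschewski X c" "is_compactification X d" "zero_dimensional_space (snd d)"
  shows "compactification_ge X c d"
proof -
  obtain d' :: "('a, 'a set set) compactification"
    where "is_compactification X d'" "compactification_equiv X d d'"
      "zero_dimensional_space (snd d')"
    using compactification_small[OF assms(2)] assms(3) by metis
  then have "compactification_ge X c d'" "compactification_ge X d' d"
    using assms compactification_equiv_imp_ge[OF compactification_equiv_sym, of X d d']
    unfolding is_banaschewski_def by blast+
  then show ?thesis
    by (rule compactification_ge_trans)
qed

lemma zero_dimensional_space_subtopology:
  "zero_dimensional_space X \<Longrightarrow> zero_dimensional_space (subtopology X S)"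
  by (simp add: zero_dimensional_space_iff_dim_le_0 dimension_le_subtopology)

lemma zero_dimensional_space_product:
  assumes "\<And>i. i \<in> I \<Longrightarrow> zero_dimensional_space (Y i)"
  shows "zero_dimensional_space (product_topology Y I)"
  unfolding zero_dimensional_space_alt
proof (intro allI impI)
  fix U p assume "openin (product_topology Y I) U \<and> p \<in> U"
  then have "\<exists>W. finite {i \<in> I. W i \<noteq> topspace (Y i)} \<and> (\<forall>i\<in>I. openin (Y i) (W i)) \<and>
      p \<in> Pi\<^sub>E I W \<and> Pi\<^sub>E I W \<subseteq> U"
    by (simp add: openin_product_topology_alt)
  then obtain W where W: "finite {i \<in> I. W i \<noteq> topspace (Y i)}"
    "\<And>i. i \<in> I \<Longrightarrow> openin (Y i) (W i)" "p \<in> Pi\<^sub>E I W" "Pi\<^sub>E I W \<subseteq> U"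
    by blast
  have "\<exists>V. openin (Y i) V \<and> closedin (Y i) V \<and> p i \<in> V \<and> V \<subseteq> W i \<and>
          (W i = topspace (Y i) \<longrightarrow> V = topspace (Y i))" if "i \<in> I" for i
  proof (cases "W i = topspace (Y i)")
    case True
    then show ?thesis using W(3) that by (auto intro!: exI[of _ "topspace (Y i)"])
  next
    case False
    then show ?thesis
      using assms[OF that] W(2)[OF that] PiE_mem[OF W(3) that]
      unfolding zero_dimensional_space_alt by blast
  qed
  then have "\<exists>V. \<forall>i\<in>I. openin (Y i) (V i) \<and> closedin (Y i) (V i) \<and> p i \<in> V i \<and> V i \<subseteq> W i \<and>
          (W i = topspace (Y i) \<longrightarrow> V i = topspace (Y i))"
    by (intro bchoice ballI)
  then obtain V where V: "\<And>i. i \<in> I \<Longrightarrow> openin (Y i) (V i)"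
    "\<And>i. i \<in> I \<Longrightarrow> closedin (Y i) (V i)" "\<And>i. i \<in> I \<Longrightarrow> p i \<in> V i"
    "\<And>i. i \<in> I \<Longrightarrow> V i \<subseteq> W i"
    "\<And>i. i \<in> I \<Longrightarrow> W i = topspace (Y i) \<Longrightarrow> V i = topspace (Y i)"
    by blast
  have "finite {i \<in> I. V i \<noteq> topspace (Y i)}"
    by (rule finite_subset[OF _ W(1)]) (use V(5) in auto)
  then have "openin (product_topology Y I) (Pi\<^sub>E I V)"
    by (simp add: openin_PiE_gen V(1))
  moreover have "closedin (product_topology Y I) (Pi\<^sub>E I V)"
    by (simp add: closedin_product_topology V(2))
  moreover have "p \<in> Pi\<^sub>E I V"
    using W(3) V(3) by (auto simp: PiE_iff)
  moreover have "Pi\<^sub>E I V \<subseteq> U"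
    using W(4) V(4) by (meson PiE_mono order_trans)
  ultimately show "\<exists>V. openin (product_topology Y I) V \<and> closedin (product_topology Y I) V \<and>
      p \<in> V \<and> V \<subseteq> U"
    by blast
qed

lemma is_compactification_closure:
  assumes e: "embedding_map X P e" and P: "compact_space P" "Hausdorff_space P"
  shows "is_compactification X (e, subtopology P (P closure_of (e ` topspace X)))"
proof -
  let ?C = "P closure_of (e ` topspace X)"
  have sub: "e ` topspace X \<subseteq> topspace P"
    using e by (rule embedding_map_image_subset)
  then have sub': "e ` topspace X \<subseteq> ?C"
    by (simp add: closure_of_subset)
  have "compact_space (subtopology P ?C)"
    using P(1) by (simp add: closedin_compact_space compact_space_subtopology)
  moreover have "Hausdorff_space (subtopology P ?C)"
    using P(2) by (rule Hausdorff_space_subtopology)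
  moreover have "embedding_map X (subtopology P ?C) e"
    using e sub' by (auto simp: embedding_map_in_subtopology)
  moreover have "subtopology P ?C closure_of (e ` topspace X) = topspace (subtopology P ?C)"
    using sub' by (simp add: closure_of_subtopology closure_of_subset_topspace
        Int_absorb1 Int_absorb2)
  ultimately show ?thesis
    by (simp add: is_compactification_def)
qed

lemma compactification_family_bound:
  fixes X :: "'a topology" and I :: "('a, 'b) compactification set"
  assumes I: "\<And>d. d \<in> I \<Longrightarrow> is_compactification X d" and "I \<noteq> {}"
  obtains c :: "('a, 'a set set) compactification"
  where "is_compactification X c" "\<And>d. d \<in> I \<Longrightarrow> compactification_ge X c d"
    "(\<And>d. d \<in> I \<Longrightarrow> zero_dimensional_space (snd d)) \<Longrightarrow> zero_dimensional_space (snd c)"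
proof -
  define P where "P = product_topology snd I"
  define e where "e x = (\<lambda>d\<in>I. fst d x)" for x
  have emb: "embedding_map X (snd d) (fst d)" if "d \<in> I" for d
    using I[OF that] by (auto simp: is_compactification_def case_prod_unfold)
  have cont: "continuous_map X P e"
    unfolding P_def e_def continuous_map_componentwise
    using emb by (auto simp: embedding_imp_continuous_map)
  obtain d0 where d0: "d0 \<in> I" using \<open>I \<noteq> {}\<close> by blast
  have "embedding_map X P e"
  proof -
    obtain s where s: "homeomorphic_maps X (subtopology (snd d0) (fst d0 ` topspace X)) (fst d0) s"
      using emb[OF d0] unfolding embedding_map_def homeomorphic_map_maps by blast
    have "continuous_map (subtopology P (e ` topspace X)) (snd d0) (\<lambda>p. p d0)"
      unfolding P_def
      by (intro continuous_map_from_subtopology continuous_map_product_projection d0)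
    then have "continuous_map (subtopology P (e ` topspace X))
        (subtopology (snd d0) (fst d0 ` topspace X)) (\<lambda>p. p d0)"
      by (auto simp: continuous_map_in_subtopology e_def d0)
    then have "continuous_map (subtopology P (e ` topspace X)) X (s \<circ> (\<lambda>p. p d0))"
      using s continuous_map_compose unfolding homeomorphic_maps_def by blast
    moreover have "continuous_map X (subtopology P (e ` topspace X)) e"
      using cont by (simp add: continuous_map_in_subtopology)
    ultimately have "homeomorphic_maps X (subtopology P (e ` topspace X)) e (s \<circ> (\<lambda>p. p d0))"
      using s by (auto simp: homeomorphic_maps_def e_def d0)
    then show ?thesis
      by (auto simp: embedding_map_def homeomorphic_maps_imp_map)
  qed
  moreover have "compact_space P" "Hausdorff_space P"
    using I by (auto simp: P_def compact_space_product_topology Hausdorff_space_product_topology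
        is_compactification_def case_prod_unfold)
  ultimately have c0: "is_compactification X (e, subtopology P (P closure_of (e ` topspace X)))"
    by (rule is_compactification_closure)
  let ?c0 = "(e, subtopology P (P closure_of (e ` topspace X)))"
  have ge: "compactification_ge X ?c0 d" if "d \<in> I" for d
  proof -
    have "continuous_map (snd ?c0) (snd d) (\<lambda>p. p d)"
      unfolding P_def snd_conv
      by (intro continuous_map_from_subtopology continuous_map_product_projection that)
    then show ?thesis
      using that
      by (auto simp: compactification_ge_def e_def case_prod_unfold intro!: exI[of _ "\<lambda>p. p d"])
  qed
  have zd: "zero_dimensional_space (snd ?c0)"
    if "\<And>d. d \<in> I \<Longrightarrow> zero_dimensional_space (snd d)"
    unfolding snd_conv P_def
    by (intro zero_dimensional_space_subtopology zero_dimensional_space_product that)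
  obtain c :: "('a, 'a set set) compactification"
    where c: "is_compactification X c" "compactification_equiv X ?c0 c"
      "zero_dimensional_space (snd ?c0) \<Longrightarrow> zero_dimensional_space (snd c)"
    using compactification_small[OF c0] by blast
  show ?thesis
  proof
    show "compactification_ge X c d" if "d \<in> I" for d
      using compactification_ge_trans[OF _ ge[OF that]]
        compactification_equiv_imp_ge[OF compactification_equiv_sym[OF c(2) c0]] by blast
  qed (use c zd in auto)
qed

theorem is_stone_cech_stone_cech:
  assumes "completely_regular_space X" "Hausdorff_space X"
  shows "is_stone_cech X (stone_cech X)"
proof -
  obtain F e where e: "embedding_map X (product_topology (\<lambda>f :: 'a \<Rightarrow> real. top_of_set {0..1::real}) F) e"
    using completely_regular_space_cube_embedding[OF assms] by blast
  have "compact_space (product_topology (\<lambda>f :: 'a \<Rightarrow> real. top_of_set {0..1::real}) F)"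
    "Hausdorff_space (product_topology (\<lambda>f :: 'a \<Rightarrow> real. top_of_set {0..1::real}) F)"
    by (auto simp: compact_space_product_topology Hausdorff_space_product_topology
        compact_space_subtopology Hausdorff_space_subtopology)
  then obtain d :: "('a, 'a set set) compactification" where "is_compactification X d"
    using compactification_small[OF is_compactification_closure[OF e]] by blast
  then obtain c :: "('a, 'a set set) compactification"
    where "is_compactification X c"
      "\<And>d. d \<in> Collect (is_compactification X :: ('a, 'a set set) compactification \<Rightarrow> bool)
         \<Longrightarrow> compactification_ge X c d"
    using compactification_family_bound[of "Collect (is_compactification X)" X] by blast
  then have "is_stone_cech X c"
    by (simp add: is_stone_cech_def)
  then show ?thesis
    unfolding stone_cech_def by (rule someI)
qed

lemma zero_dimensional_embedding:
  fixes X :: "'a topology"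
  assumes X: "zero_dimensional_space X" "Hausdorff_space X"
  defines "\<C> \<equiv> {C. openin X C \<and> closedin X C}"
  defines "P \<equiv> product_topology (\<lambda>_ :: 'a set. discrete_topology (UNIV :: bool set)) \<C>"
  shows "embedding_map X P (\<lambda>x. \<lambda>C\<in>\<C>. x \<in> C)"
proof -
  define e where "e x = (\<lambda>C\<in>\<C>. x \<in> C)" for x :: 'a
  have cont: "continuous_map X P e"
    unfolding P_def e_def continuous_map_componentwise
  proof (intro conjI ballI)
    fix C assume C: "C \<in> \<C>"
    have *: "openin X {x \<in> topspace X. (x \<in> C) \<in> U}" for U :: "bool set"
    proof -
      have "{x \<in> topspace X. (x \<in> C) \<in> U} =
          (if True \<in> U then C else {}) \<union> (if False \<in> U then topspace X - C else {})"
        using C openin_subset[of X C] by (auto simp: \<C>_def) (metis (full_types))+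
      moreover have "openin X (topspace X - C)"
        using C by (simp add: \<C>_def openin_diff)
      ultimately show ?thesis
        using C by (auto simp: \<C>_def)
    qed
    show "continuous_map X (discrete_topology UNIV) (\<lambda>x. (\<lambda>C\<in>\<C>. x \<in> C) C)"
      using C * by (simp add: continuous_map_def)
  qed auto
  have inj: "inj_on e (topspace X)"
  proof (rule inj_onI, rule ccontr)
    fix x y assume xy: "x \<in> topspace X" "y \<in> topspace X" "e x = e y" "x \<noteq> y"
    then obtain U where "openin X U" "x \<in> U" "y \<notin> U"
      using X(2) unfolding Hausdorff_space_def by (meson disjnt_iff)
    then obtain C where "C \<in> \<C>" "x \<in> C" "y \<notin> C"
      using X(1) unfolding zero_dimensional_space_alt \<C>_def by blast
    then show False
      using fun_cong[OF xy(3), of C] by (simp add: e_def)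
  qed
  have "open_map X (subtopology P (e ` topspace X)) e"
    unfolding open_map_def
  proof (intro allI impI)
    fix U assume U: "openin X U"
    show "openin (subtopology P (e ` topspace X)) (e ` U)"
    proof (subst openin_subopen, intro ballI)
      fix p assume "p \<in> e ` U"
      then obtain x where x: "x \<in> U" "p = e x" by blast
      then obtain C where C: "C \<in> \<C>" "x \<in> C" "C \<subseteq> U"
        using X(1) U unfolding zero_dimensional_space_alt \<C>_def by blast
      have "openin P {p \<in> topspace P. p C \<in> {True}}"
        unfolding P_def
        by (rule openin_continuous_map_preimage[OF continuous_map_product_projection[OF C(1)]]) simp
      then have "openin (subtopology P (e ` topspace X))
          ({p \<in> topspace P. p C \<in> {True}} \<inter> (e ` topspace X))"
        by (rule openin_subtopology_Int)
      moreover have "{p \<in> topspace P. p C \<in> {True}} \<inter> (e ` topspace X) \<subseteq> e ` U"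
        using C by (auto simp: e_def)
      moreover have "x \<in> topspace X" using x U openin_subset by blast
      then have "p \<in> {p \<in> topspace P. p C \<in> {True}} \<inter> (e ` topspace X)"
        using C x continuous_map_image_subset_topspace[OF cont] by (auto simp: e_def)
      ultimately show "\<exists>T. openin (subtopology P (e ` topspace X)) T \<and> p \<in> T \<and> T \<subseteq> e ` U"
        by blast
    qed
  qed
  moreover have "continuous_map X (subtopology P (e ` topspace X)) e"
    using cont by (simp add: continuous_map_in_subtopology)
  moreover have "e ` topspace X = topspace (subtopology P (e ` topspace X))"
    using continuous_map_image_subset_topspace[OF cont] by auto
  ultimately have "embedding_map X P e"
    unfolding embedding_map_def using inj by (intro bijective_open_imp_homeomorphic_map)
  then show ?thesis
    by (simp add: e_def[abs_def])
qed

theorem is_banaschewski_banaschewski: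
  assumes "zero_dimensional_space X" "Hausdorff_space X"
  shows "is_banaschewski X (banaschewski X)"
proof -
  let ?P = "product_topology (\<lambda>_ :: 'a set. discrete_topology (UNIV :: bool set))
    {C. openin X C \<and> closedin X C}"
  have "compact_space ?P" "Hausdorff_space ?P"
    by (auto simp: compact_space_product_topology Hausdorff_space_product_topology
        compact_space_discrete_topology)
  then have "is_compactification X ((\<lambda>x. \<lambda>C\<in>{C. openin X C \<and> closedin X C}. x \<in> C),
      subtopology ?P (?P closure_of
        ((\<lambda>x. \<lambda>C\<in>{C. openin X C \<and> closedin X C}. x \<in> C) ` topspace X)))"
    (is "is_compactification X ?d0")
    by (rule is_compactification_closure[OF zero_dimensional_embedding[OF assms]])
  moreover have "zero_dimensional_space ?P"
    by (rule zero_dimensional_space_product) (auto simp: zero_dimensional_space_alt)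
  then have "zero_dimensional_space (snd ?d0)"
    by (simp add: zero_dimensional_space_subtopology)
  ultimately obtain d :: "('a, 'a set set) compactification"
    where d: "is_compactification X d \<and> zero_dimensional_space (snd d)"
    using compactification_small[of X ?d0] by blast
  let ?I = "{d :: ('a, 'a set set) compactification.
    is_compactification X d \<and> zero_dimensional_space (snd d)}"
  obtain c :: "('a, 'a set set) compactification"
    where "is_compactification X c" "\<And>d. d \<in> ?I \<Longrightarrow> compactification_ge X c d"
      "zero_dimensional_space (snd c)"
  proof (rule compactification_family_bound[of ?I X])
    show "?I \<noteq> {}" using d by blast
  qed auto
  then have "is_banaschewski X c"
    by (simp add: is_banaschewski_def)
  then show ?thesis
    unfolding banaschewski_def by (rule someI)
qed

end

theory Submission
  imports Defs "HOL-Algebra.Ring_Divisibility"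
begin

text \<open>A function with countable range omits values arbitrarily close to any given one, so it can be
  cut along clopen sets. Hence if \<open>f\<close> lies outside a maximal ideal \<open>M\<close>, so does the characteristic
  function of some clopen set that is a multiple of \<open>f\<close>: the maximal ideals are separated by clopen
  subsets of \<open>X\<close>. A compactification that is zero-dimensional and dominates the structure space
  is then equivalent to it, because any two of its points are separated by a clopen set, whose
  trace on \<open>X\<close> is clopen and so separates their images.\<close>

(* the import brings back the notation that clashes with the topological closure *)
no_notation eq_closure_of (\<open>closure'_of\<index>\<close>)

section \<open>Maximal ideals of a commutative ring\<close>

lemma (in cring) exists_maximalideal:
  assumes "ideal I R" "\<one> \<notin> I"
  obtains M where "maximalideal M R" "I \<subseteq> M"
proof -
  \<comment> \<open>Properness is expressed as \<open>\<one> \<notin> J\<close>, a condition that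
    passes to unions of chains.\<close>
  let ?\<A> = "{J. ideal J R \<and> I \<subseteq> J \<and> \<one> \<notin> J}"
  have "\<exists>M\<in>?\<A>. \<forall>J\<in>?\<A>. M \<subseteq> J \<longrightarrow> J = M"
  proof (rule subset_Zorn_nonempty)
    show "?\<A> \<noteq> {}" using assms by blast
  next
    fix \<C> assume \<C>: "\<C> \<noteq> {}" "subset.chain ?\<A> \<C>"
    then have "subset.chain {J. ideal J R} \<C>"
      by (auto simp: subset_chain_def)
    then have "ideal (\<Union>\<C>) R"
      using chain_Union_is_ideal[of \<C>] \<C>(1) by simp
    then show "\<Union>\<C> \<in> ?\<A>"
      using \<C> by (auto simp: subset_chain_def)
  qed
  then obtain M where "M \<in> ?\<A>" and max: "\<forall>J\<in>?\<A>. M \<subseteq> J \<longrightarrow> J = M"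
    by (rule bexE)
  then have M: "ideal M R" "I \<subseteq> M" "\<one> \<notin> M"
    by simp_all
  have "maximalideal M R"
  proof (rule maximalidealI[OF M(1)])
    show "carrier R \<noteq> M" using M(3) by auto
  next
    fix J assume J: "ideal J R" "M \<subseteq> J"
    show "J = M \<or> J = carrier R"
    proof (cases "\<one> \<in> J")
      case True
      then show ?thesis using ideal.one_imp_carrier[OF J(1)] by blast
    next
      case False
      then show ?thesis using max J M(2) by simp
    qed
  qed
  then show thesis using that M(2) by blast
qed

text \<open>Invertibility of \<open>a\<close> in the residue field \<open>R/M\<close>, written
  inside \<open>R\<close>: the ideal generated by \<open>M\<close> and \<open>a\<close> exceeds
  \<open>M\<close>, so it contains \<open>\<one>\<close>.\<close>

lemma (in cring) maximalideal_inverse_mod: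
  assumes "maximalideal M R" "a \<in> carrier R" "a \<notin> M"
  obtains m b where "m \<in> M" "b \<in> carrier R" "m \<oplus> b \<otimes> a = \<one>"
proof -
  interpret maximalideal M R by fact
  have I: "ideal (M <+> PIdl a) R"
    by (rule add_ideals[OF is_ideal cgenideal_ideal[OF assms(2)]])
  have sub: "M \<subseteq> M <+> PIdl a"
  proof
    fix m assume m: "m \<in> M"
    have "m = m \<oplus> \<zero>" using m a_Hcarr by simp
    moreover have "\<zero> \<in> PIdl a"
      using additive_subgroup.zero_closed ideal.axioms(1) cgenideal_ideal[OF assms(2)] by blast
    ultimately show "m \<in> M <+> PIdl a"
      unfolding set_add_def' using m by blast
  qed
  have "a = \<zero> \<oplus> a" using assms(2) by simp
  then have "a \<in> M <+> PIdl a"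
    unfolding set_add_def' using cgenideal_self[OF assms(2)] zero_closed by blast
  then have "M <+> PIdl a = carrier R"
    using I_maximal[OF I sub] assms(3) ideal.Icarr[OF I] by blast
  then have "\<one> \<in> M <+> PIdl a" by simp
  then show thesis
    using that unfolding set_add_def' cgenideal_def by auto
qed

section \<open>The hull-kernel topology: basic neighbourhoods and compactness\<close>

lemma openin_structure_space_basic:
  assumes "cring R" "a \<in> carrier R"
  shows "openin (structure_space R) {M \<in> max_ideals R. a \<notin> M}"
  unfolding openin_structure_space[OF assms(1)]
  by (rule arbitrary_union_of_inc) (use assms(2) in blast)

lemma openin_structure_space_nbhd:
  assumes "cring R" "openin (structure_space R) U" "M \<in> U"
  obtains a where "a \<in> carrier R" "a \<notin> M" "{M \<in> max_ideals R. a \<notin> M} \<subseteq> U"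
proof -
  let ?P = "\<lambda>U. \<exists>a\<in>carrier R. U = max_ideals R - {M \<in> max_ideals R. a \<in> M}"
  obtain \<V> where \<V>: "\<V> \<subseteq> Collect ?P" "\<Union>\<V> = U"
    using assms(2) unfolding openin_structure_space[OF assms(1)] union_of_def arbitrary_def
    by blast
  then obtain V where "V \<in> \<V>" "M \<in> V" using assms(3) by blast
  then obtain a where "a \<in> carrier R" "V = max_ideals R - {M \<in> max_ideals R. a \<in> M}"
    using \<V>(1) by blast
  then show thesis
    using that[of a] \<V>(2) \<open>V \<in> \<V>\<close> \<open>M \<in> V\<close> by blast
qed

text \<open>The elements whose basic open set is covered by finitely many members of a given cover form
  an ideal, which lies in no maximal ideal.\<close>

lemma compact_structure_space:
  fixes R (structure)
  assumes "cring R"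
  shows "compact_space (structure_space R)"
  unfolding compact_space_alt topspace_structure_space[OF assms]
proof (intro allI impI, elim conjE)
  interpret cring R by fact
  fix \<U> assume op: "\<forall>U\<in>\<U>. openin (structure_space R) U" and cover: "max_ideals R \<subseteq> \<Union>\<U>"
  define D where "D a = {M \<in> max_ideals R. a \<notin> M}" for a
  define J where "J = {a \<in> carrier R. \<exists>\<F>. finite \<F> \<and> \<F> \<subseteq> \<U> \<and> D a \<subseteq> \<Union>\<F>}"
  have idl: "ideal M R" if "M \<in> max_ideals R" for M
    using that by (simp add: max_ideals_def maximalideal.axioms(1))
  note sub = additive_subgroup.a_closed[OF ideal.axioms(1)[OF idl]]
    additive_subgroup.zero_closed[OF ideal.axioms(1)[OF idl]]
    additive_subgroup.a_inv_closed[OF ideal.axioms(1)[OF idl]]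
  \<comment> \<open>Gives closure of \<open>J\<close> under negatives and multiples, since neither
    enlarges \<open>D a\<close>.\<close>
  have D_smaller: "b \<in> J" if "a \<in> J" "b \<in> carrier R" "D b \<subseteq> D a" for a b
  proof -
    obtain \<F> where "finite \<F>" "\<F> \<subseteq> \<U>" "D a \<subseteq> \<Union>\<F>"
      using \<open>a \<in> J\<close> unfolding J_def by blast
    moreover have "D b \<subseteq> \<Union>\<F>"
      using \<open>D b \<subseteq> D a\<close> \<open>D a \<subseteq> \<Union>\<F>\<close> by (rule subset_trans)
    ultimately show ?thesis
      using \<open>b \<in> carrier R\<close> unfolding J_def by blast
  qed
  have "ideal J R"
  proof (rule idealI[OF ring_axioms])
    show "subgroup J (add_monoid R)"
    proof (rule add.subgroupI)
      show "J \<subseteq> carrier R" by (auto simp: J_def)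
      have "D \<zero> = {}" using sub(2) by (auto simp: D_def)
      then have "\<zero> \<in> J" by (auto simp: J_def intro!: exI[of _ "{}"])
      then show "J \<noteq> {}" by blast
    next
      fix a assume a: "a \<in> J"
      then have ac: "a \<in> carrier R" by (simp add: J_def)
      have "D (\<ominus> a) \<subseteq> D a"
        using sub(3) by (auto simp: D_def)
      then show "\<ominus> a \<in> J" using D_smaller a ac by blast
    next
      fix a b assume ab: "a \<in> J" "b \<in> J"
      then obtain \<F> \<G> where F: "finite \<F>" "\<F> \<subseteq> \<U>" "D a \<subseteq> \<Union>\<F>"
        and G: "finite \<G>" "\<G> \<subseteq> \<U>" "D b \<subseteq> \<Union>\<G>"
        by (auto simp: J_def)
      have "D (a \<oplus> b) \<subseteq> D a \<union> D b"
        using sub(1) by (auto simp: D_def)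
      also have "\<dots> \<subseteq> \<Union>(\<F> \<union> \<G>)" using F G by auto
      finally show "a \<oplus> b \<in> J"
        using ab F G by (auto simp: J_def intro!: exI[of _ "\<F> \<union> \<G>"])
    qed
  next
    fix a x assume a: "a \<in> J" and x: "x \<in> carrier R"
    then have ac: "a \<in> carrier R" by (simp add: J_def)
    have "D (x \<otimes> a) \<subseteq> D a"
      using x ideal.I_l_closed[OF idl] by (auto simp: D_def)
    then show "x \<otimes> a \<in> J" using D_smaller a ac x by blast
    then show "a \<otimes> x \<in> J" using m_comm ac x by simp
  qed
  have "\<one> \<in> J"
  proof (rule ccontr)
    assume "\<one> \<notin> J"
    then obtain M where M: "maximalideal M R" "J \<subseteq> M"
      using exists_maximalideal \<open>ideal J R\<close> by blast
    then obtain U where U: "U \<in> \<U>" "M \<in> U"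
      using cover by (auto simp: max_ideals_def)
    \<comment> \<open>A basic neighbourhood of \<open>M\<close> inside the single member
      \<open>U\<close> puts \<open>a\<close> into \<open>J\<close>, although
      \<open>a \<notin> M\<close>.\<close>
    then obtain a where a: "a \<in> carrier R" "a \<notin> M" "D a \<subseteq> U"
      using openin_structure_space_nbhd[OF assms] op unfolding D_def by metis
    then have "a \<in> J"
      using U by (auto simp: J_def intro!: exI[of _ "{U}"])
    then show False using a M by blast
  qed
  moreover have "D \<one> = max_ideals R"
    using ideal.one_imp_carrier[OF idl] maximalideal.I_notcarr
    by (auto simp: D_def max_ideals_def)
  ultimately show "\<exists>\<F>. finite \<F> \<and> \<F> \<subseteq> \<U> \<and> max_ideals R \<subseteq> \<Union>\<F>"
    by (simp add: J_def)
qed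

section \<open>Continuous functions of countable range and clopen sets\<close>

lemma cring_cont_ring: "cring (cont_ring X)"
proof -
  have "abelian_group (cont_ring X)"
  proof (rule abelian_groupI)
    fix f assume f: "f \<in> carrier (cont_ring X)"
    have "(\<lambda>x\<in>topspace X. - f x) \<in> carrier (cont_ring X)"
      using f by (simp add: cont_ring_def cont_funs_def continuous_map_minus)
    moreover have "(\<lambda>x\<in>topspace X. - f x) \<oplus>\<^bsub>cont_ring X\<^esub> f = \<zero>\<^bsub>cont_ring X\<^esub>"
      by (simp add: cont_ring_def cong: restrict_cong)
    ultimately show "\<exists>g\<in>carrier (cont_ring X). g \<oplus>\<^bsub>cont_ring X\<^esub> f = \<zero>\<^bsub>cont_ring X\<^esub>"
      by blast
  next
    fix f assume "f \<in> carrier (cont_ring X)"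
    \<comment> \<open>Sums are restricted to \<open>topspace X\<close>, so the neutral law holds
      because \<open>f\<close> is already \<open>undefined\<close> elsewhere.\<close>
    then have "f \<in> extensional (topspace X)"
      by (simp add: cont_ring_def cont_funs_def)
    then show "\<zero>\<^bsub>cont_ring X\<^esub> \<oplus>\<^bsub>cont_ring X\<^esub> f = f"
      by (simp add: cont_ring_def extensional_restrict cong: restrict_cong)
  qed (simp_all add: cont_ring_def cont_funs_def continuous_map_add ac_simps cong: restrict_cong)
  moreover have "comm_monoid (cont_ring X)"
  proof (rule comm_monoidI)
    fix f assume "f \<in> carrier (cont_ring X)"
    then have "f \<in> extensional (topspace X)"
      by (simp add: cont_ring_def cont_funs_def)
    then show "\<one>\<^bsub>cont_ring X\<^esub> \<otimes>\<^bsub>cont_ring X\<^esub> f = f"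
      by (simp add: cont_ring_def extensional_restrict cong: restrict_cong)
  qed (simp_all add: cont_ring_def cont_funs_def continuous_map_real_mult ac_simps cong: restrict_cong)
  ultimately show ?thesis
    by (rule cringI) (simp add: cont_ring_def distrib_right cong: restrict_cong)
qed

definition char_fun :: "'a topology \<Rightarrow> 'a set \<Rightarrow> 'a \<Rightarrow> real" where
  "char_fun X U = (\<lambda>x\<in>topspace X. if x \<in> U then 1 else 0)"

lemma continuous_map_char_fun:
  assumes "openin X U" "closedin X U"
  shows "continuous_map X euclideanreal (char_fun X U)"
  unfolding continuous_map
proof (intro conjI allI impI)
  fix W :: "real set"
  have "openin X (topspace X - U)" using assms(2) by blast
  moreover have "{x \<in> topspace X. char_fun X U x \<in> W} =
      (if 1 \<in> W then U else {}) \<union> (if 0 \<in> W then topspace X - U else {})"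
    using openin_subset[OF assms(1)] by (auto simp: char_fun_def)
  ultimately show "openin X {x \<in> topspace X. char_fun X U x \<in> W}"
    using assms(1) by auto
qed auto

text \<open>Being bounded away from zero on \<open>U\<close> makes the local inverse bounded, and
  its values are reciprocals from a countable set, or 0. Hence it lies in every ring above
  \<open>Cc_star X\<close>, even if \<open>g\<close> is unbounded.\<close>

lemma Cc_star_clopen_inverse:
  assumes U: "openin X U" "closedin X U" and g: "g \<in> Cc X"
    and r: "0 < r" "\<And>x. x \<in> U \<Longrightarrow> r \<le> \<bar>g x\<bar>"
  shows "(\<lambda>x\<in>topspace X. if x \<in> U then 1 / g x else 0) \<in> Cc_star X" (is "?k \<in> _")
proof -
  let ?e = "char_fun X U"
  have gc: "continuous_map X euclideanreal g" and cnt: "countable (g ` topspace X)"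
    using g by (auto simp: Cc_def cont_funs_def)
  have nz: "g x \<noteq> 0" if "x \<in> U" for x
    using r that by force
  \<comment> \<open>the denominator agrees with \<open>g\<close> on \<open>U\<close> and vanishes nowhere\<close>
  have "continuous_map X euclideanreal (\<lambda>x. ?e x / (?e x * g x + (1 - ?e x)))"
    by (intro continuous_intros continuous_map_char_fun U gc) (simp add: char_fun_def nz)
  then have "continuous_map X euclideanreal ?k"
    by (rule continuous_map_eq) (simp add: char_fun_def)
  moreover have "?k ` topspace X \<subseteq> insert 0 ((\<lambda>y. 1 / y) ` g ` topspace X)"
    by auto
  then have "countable (?k ` topspace X)"
    by (rule countable_subset) (simp add: cnt)
  moreover have "\<bar>?k x\<bar> \<le> 1 / r" if "x \<in> topspace X" for x
    using r that by (auto simp: frac_le)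
  then have "bounded (?k ` topspace X)"
    unfolding bounded_iff real_norm_def by blast
  ultimately show ?thesis
    by (simp add: Cc_star_def Cc_def cont_funs_def)
qed

text \<open>The interval (0,1) is uncountable, so \<open>f\<close> omits some \<open>r\<close> in
  it; then \<open>f > r\<close> and \<open>f \<ge> r\<close> define the same set, which is open by
  the first form and closed by the second.\<close>

lemma Cc_clopen_cut:
  assumes "f \<in> Cc X"
  obtains r where "0 < r" "r < 1" "openin X {x \<in> topspace X. f x > r}"
    "closedin X {x \<in> topspace X. f x > r}" "\<And>x. x \<in> topspace X \<Longrightarrow> f x \<noteq> r"
proof -
  have f: "continuous_map X euclideanreal f" "countable (f ` topspace X)"
    using assms by (auto simp: Cc_def cont_funs_def)
  have "uncountable {0<..<1::real}"
    by (simp add: uncountable_open_interval)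
  then obtain r where r: "0 < r" "r < 1" "r \<notin> f ` topspace X"
    using f(2) countable_subset[of "{0<..<1}" "f ` topspace X"] by fastforce
  have "openin X {x \<in> topspace X. f x \<in> {r<..}}"
    using f(1) by (rule openin_continuous_map_preimage) simp
  moreover have "closedin X {x \<in> topspace X. f x \<in> {r..}}"
    using f(1) by (rule closedin_continuous_map_preimage) simp
  moreover have "{x \<in> topspace X. f x \<in> {r..}} = {x \<in> topspace X. f x > r}"
    using r(3) by (auto simp: order_le_less)
  ultimately show thesis using that r by auto
qed

section \<open>The intermediate ring: clopen sets and maximal ideals\<close>

locale Cc_intermediate_ring =
  fixes X :: "'a topology" and A :: "('a \<Rightarrow> real) set"
  assumes subring: "subring A (cont_ring X)"
    and Cc_star_le: "Cc_star X \<subseteq> A" and le_Cc: "A \<subseteq> Cc X"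
begin

abbreviation R :: "('a \<Rightarrow> real) ring" where
  "R \<equiv> (cont_ring X)\<lparr>carrier := A\<rparr>"

abbreviation E :: "'a set \<Rightarrow> 'a \<Rightarrow> real" where
  "E \<equiv> char_fun X"

lemma R_simps:
  "carrier R = A" "\<one>\<^bsub>R\<^esub> = (\<lambda>x\<in>topspace X. 1)" "\<zero>\<^bsub>R\<^esub> = (\<lambda>x\<in>topspace X. 0)"
  "f \<otimes>\<^bsub>R\<^esub> g = (\<lambda>x\<in>topspace X. f x * g x)" "f \<oplus>\<^bsub>R\<^esub> g = (\<lambda>x\<in>topspace X. f x + g x)"
  by (simp_all add: cont_ring_def)

text \<open>Simplification strips the carrier update from the ring operations; these equations are
  put in the form that matches afterwards.\<close>

lemmas R_eval = R_simps(1) R_simps(2-5)[simplified]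

sublocale cring R
proof -
  interpret C: cring "cont_ring X" by (rule cring_cont_ring)
  have sub: "A \<subseteq> carrier (cont_ring X)"
    using subringE(1)[OF subring] .
  show "cring R"
    by (rule cring.intro[OF C.subring_is_ring[OF subring]],
        rule monoid.monoid_comm_monoidI[OF ring.is_monoid[OF C.subring_is_ring[OF subring]]])
      (use sub C.m_comm in auto)
qed

text \<open>Makes \<open>E U\<close> a multiple of \<open>g\<close> within the ring, so every ideal
  containing \<open>g\<close> contains \<open>E U\<close>.\<close>

lemma clopen_inverse:
  assumes "openin X U" "closedin X U" "g \<in> A" "0 < r" "\<And>x. x \<in> U \<Longrightarrow> r \<le> \<bar>g x\<bar>"
  obtains k where "k \<in> A" "k \<otimes>\<^bsub>R\<^esub> g = E U"
proof
  show "(\<lambda>x\<in>topspace X. if x \<in> U then 1 / g x else 0) \<in> A" (is "?k \<in> A")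
    using Cc_star_clopen_inverse[of X U g r] assms Cc_star_le le_Cc by blast
  have "g x \<noteq> 0" if "x \<in> U" for x
    using assms(4,5) that by force
  then show "?k \<otimes>\<^bsub>R\<^esub> g = E U"
    by (auto simp: R_eval char_fun_def)
qed

lemma char_fun_in_A:
  assumes "openin X U" "closedin X U"
  shows "E U \<in> A"
proof -
  \<comment> \<open>The unit is bounded below by 1 everywhere, and its multiple \<open>E U\<close>
    is then \<open>k\<close> itself.\<close>
  obtain k where "k \<in> A" "k \<otimes>\<^bsub>R\<^esub> \<one>\<^bsub>R\<^esub> = E U"
    using clopen_inverse[OF assms, of "\<one>\<^bsub>R\<^esub>" 1] one_closed openin_subset[OF assms(1)]
    by (force simp: R_eval)
  then show ?thesis using r_one by (simp add: R_simps(1))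
qed

lemma
  assumes "M \<in> max_ideals R"
  shows max_ideal_ideal: "ideal M R" and one_notin_max_ideal: "\<one>\<^bsub>R\<^esub> \<notin> M"
proof -
  interpret maximalideal M R using assms by (simp add: max_ideals_def)
  show "ideal M R" by (rule is_ideal)
  show "\<one>\<^bsub>R\<^esub> \<notin> M" using one_imp_carrier I_notcarr by blast
qed

text \<open>Complementary idempotents: their product is zero, so the prime ideal \<open>M\<close>
  contains one of them; their sum is the unit, so it cannot contain both.\<close>

lemma char_fun_compl_in_max_ideal:
  assumes U: "openin X U" "closedin X U" and M: "M \<in> max_ideals R"
  shows "E (topspace X - U) \<in> M \<longleftrightarrow> E U \<notin> M"
proof -
  interpret maximalideal M R using M by (simp add: max_ideals_def)
  interpret P: primeideal M R by (rule maximalideal_prime[OF is_maximalideal])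
  have A: "E U \<in> carrier R" "E (topspace X - U) \<in> carrier R"
    using U char_fun_in_A[of U] char_fun_in_A[of "topspace X - U"]
    by (auto simp: R_simps(1) openin_diff closedin_diff)
  have "E (topspace X - U) \<otimes>\<^bsub>R\<^esub> E U = \<zero>\<^bsub>R\<^esub>"
    by (auto simp: R_eval char_fun_def)
  then have "E (topspace X - U) \<in> M \<or> E U \<in> M"
    using P.I_prime A zero_closed by simp
  moreover have "E (topspace X - U) \<oplus>\<^bsub>R\<^esub> E U = \<one>\<^bsub>R\<^esub>"
    by (auto simp: R_eval char_fun_def)
  then have "\<not> (E (topspace X - U) \<in> M \<and> E U \<in> M)"
    using a_closed one_notin_max_ideal[OF M] by metis
  ultimately show ?thesis by blast
qed

text \<open>As \<open>f \<notin> M\<close>, some multiple \<open>h\<close> of \<open>f\<close> has \<open>1 - h \<in> M\<close>; cutting at a value that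
  \<open>h\<close> omits makes \<open>h\<close> invertible on a clopen set and \<open>1 - h\<close> invertible off it.\<close>

lemma max_ideal_char_fun:
  assumes M: "M \<in> max_ideals R" and f: "f \<in> A" "f \<notin> M"
  obtains U where "openin X U" "closedin X U" "E U \<notin> M"
    "\<forall>N\<in>max_ideals R. E U \<notin> N \<longrightarrow> f \<notin> N"
proof -
  interpret maximalideal M R using M by (simp add: max_ideals_def)
  obtain m b where mb: "m \<in> M" "b \<in> A" "m \<oplus>\<^bsub>R\<^esub> b \<otimes>\<^bsub>R\<^esub> f = \<one>\<^bsub>R\<^esub>"
    using maximalideal_inverse_mod[OF is_maximalideal] f unfolding R_simps(1) by metis
  define h where "h = b \<otimes>\<^bsub>R\<^esub> f"
  have h: "h \<in> A" and mA: "m \<in> A"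
    using m_closed[of b f] mb f a_Hcarr[of m] unfolding h_def R_simps(1) by auto
  obtain r where r: "0 < r" "r < 1"
    and U: "openin X {x \<in> topspace X. h x > r}" "closedin X {x \<in> topspace X. h x > r}"
    and nr: "\<And>x. x \<in> topspace X \<Longrightarrow> h x \<noteq> r"
    using Cc_clopen_cut[of h X] h le_Cc by blast
  let ?U = "{x \<in> topspace X. h x > r}"
  \<comment> \<open>On \<open>?U\<close> the function \<open>h\<close> exceeds \<open>r\<close>, so
    \<open>E ?U\<close> is a multiple of \<open>h\<close>, hence of \<open>f\<close>.\<close>
  obtain k where k: "k \<in> A" "k \<otimes>\<^bsub>R\<^esub> h = E ?U"
    using clopen_inverse[OF U h r(1)] by force
  have mh: "m x = 1 - h x" if "x \<in> topspace X" for x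
    using fun_cong[OF mb(3), of x] that unfolding h_def R_simps by simp
  have V: "openin X (topspace X - ?U)" "closedin X (topspace X - ?U)"
    using U by (auto simp: openin_diff closedin_diff)
  \<comment> \<open>Off \<open>?U\<close> the omitted value forces \<open>h < r\<close>, so
    \<open>m = 1 - h\<close> is bounded away from zero there.\<close>
  have "1 - r \<le> \<bar>m x\<bar>" if "x \<in> topspace X - ?U" for x
    using that mh[of x] nr[of x] r by auto
  then obtain l where l: "l \<in> A" "l \<otimes>\<^bsub>R\<^esub> m = E (topspace X - ?U)"
    using clopen_inverse[OF V mA, of "1 - r"] r by auto
  show thesis
  proof
    show "E ?U \<notin> M"
      \<comment> \<open>The complementary idempotent is a multiple of \<open>m \<in> M\<close>, so
        it lies in \<open>M\<close> and \<open>E ?U\<close> does not.\<close>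
      using char_fun_compl_in_max_ideal[OF U M] I_l_closed[OF mb(1), of l] l
      unfolding R_simps(1) by auto
    show "\<forall>N\<in>max_ideals R. E ?U \<notin> N \<longrightarrow> f \<notin> N"
    proof (intro ballI impI notI)
      fix N assume N: "N \<in> max_ideals R" and "E ?U \<notin> N" and "f \<in> N"
      have "k \<otimes>\<^bsub>R\<^esub> (b \<otimes>\<^bsub>R\<^esub> f) \<in> N"
        by (intro ideal.I_l_closed[OF max_ideal_ideal[OF N]]) (simp_all add: mb k \<open>f \<in> N\<close>)
      then show False using \<open>E ?U \<notin> N\<close> k(2) h_def by simp
    qed
  qed (use U in auto)
qed

section \<open>A clopen base of the structure space\<close>

definition B :: "'a set \<Rightarrow> ('a \<Rightarrow> real) set set" where
  "B U = {M \<in> max_ideals R. E U \<notin> M}"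

lemma topspace_MaxA: "topspace (structure_space R) = max_ideals R"
  by (rule topspace_structure_space[OF is_cring])

text \<open>The complement of \<open>B U\<close> is \<open>B (topspace X - U)\<close>, again a basic
  open set.\<close>

lemma clopen_B:
  assumes "openin X U" "closedin X U"
  shows "openin (structure_space R) (B U)" "closedin (structure_space R) (B U)"
proof -
  have o: "openin (structure_space R) (B V)" if "openin X V" "closedin X V" for V
    unfolding B_def
    by (rule openin_structure_space_basic[OF is_cring]) (simp add: char_fun_in_A that)
  show "openin (structure_space R) (B U)" using o assms by blast
  have "max_ideals R - B U = B (topspace X - U)"
    using char_fun_compl_in_max_ideal[OF assms] by (auto simp: B_def)
  moreover have "openin (structure_space R) (B (topspace X - U))"
    using o assms by (simp add: openin_diff closedin_diff)
  ultimately show "closedin (structure_space R) (B U)"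
    unfolding closedin_def topspace_MaxA by (auto simp: B_def)
qed

lemma B_base:
  assumes "openin (structure_space R) W" "M \<in> W"
  obtains U where "openin X U" "closedin X U" "M \<in> B U" "B U \<subseteq> W"
proof -
  obtain f where f: "f \<in> carrier R" "f \<notin> M" "{M \<in> max_ideals R. f \<notin> M} \<subseteq> W"
    by (rule openin_structure_space_nbhd[OF is_cring assms])
  then have fA: "f \<in> A" by simp
  have M: "M \<in> max_ideals R"
    using openin_subset[OF assms(1)] assms(2) topspace_MaxA by blast
  obtain U where "openin X U" "closedin X U" "E U \<notin> M"
    "\<forall>N\<in>max_ideals R. E U \<notin> N \<longrightarrow> f \<notin> N"
    by (rule max_ideal_char_fun[OF M fA f(2)])
  then show thesis
    using f(3) M by (intro that[of U]) (auto simp: B_def)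
qed

lemma zero_dimensional_MaxA: "zero_dimensional_space (structure_space R)"
  unfolding zero_dimensional_space_alt
proof (intro allI impI)
  fix W M assume "openin (structure_space R) W \<and> M \<in> W"
  then obtain U where "openin X U" "closedin X U" "M \<in> B U" "B U \<subseteq> W"
    using B_base by metis
  then show "\<exists>V. openin (structure_space R) V \<and> closedin (structure_space R) V \<and> M \<in> V \<and> V \<subseteq> W"
    using clopen_B by (intro exI[of _ "B U"]) auto
qed

lemma Hausdorff_MaxA: "Hausdorff_space (structure_space R)"
  unfolding Hausdorff_space_def topspace_MaxA
proof (intro allI impI, elim conjE)
  fix M N assume M: "M \<in> max_ideals R" and N: "N \<in> max_ideals R" and "M \<noteq> N"
  interpret M: maximalideal M R using M by (simp add: max_ideals_def)
  interpret N: maximalideal N R using N by (simp add: max_ideals_def)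
  have "\<not> N \<subseteq> M"
    \<comment> \<open>Distinct maximal ideals are incomparable.\<close>
    using N.I_maximal[OF M.is_ideal] M.a_subset M.I_notcarr \<open>M \<noteq> N\<close> by blast
  then obtain f where f: "f \<in> N" "f \<notin> M" by blast
  then have "f \<in> A" using N.a_subset R_simps(1) by blast
  \<comment> \<open>If \<open>E U\<close> were outside \<open>N\<close>, the choice of
    \<open>U\<close> would put \<open>f\<close> outside \<open>N\<close>.\<close>
  then obtain U where U: "openin X U" "closedin X U" "E U \<notin> M" "E U \<in> N"
    using max_ideal_char_fun[OF M _ f(2)] N f(1) by metis
  then have V: "openin X (topspace X - U)" "closedin X (topspace X - U)"
    by (auto simp: openin_diff closedin_diff)
  have "M \<in> B U" "N \<in> B (topspace X - U)" "disjnt (B U) (B (topspace X - U))"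
    using U M N char_fun_compl_in_max_ideal[OF U(1,2)] by (auto simp: B_def disjnt_def)
  then show "\<exists>V W. openin (structure_space R) V \<and> openin (structure_space R) W \<and>
      M \<in> V \<and> N \<in> W \<and> disjnt V W"
    using clopen_B(1)[OF U(1,2)] clopen_B(1)[OF V] by blast
qed

section \<open>The space embedded by its fixed ideals\<close>

lemma fixed_ideal_in_max_ideals:
  assumes x: "x \<in> topspace X"
  shows "fixed_ideal A x \<in> max_ideals R"
proof -
  \<comment> \<open>The ring only provides an abstract additive inverse; its value at
    \<open>x\<close> is read off from \<open>l_neg\<close>.\<close>
  have minus: "(\<ominus>\<^bsub>R\<^esub> f) x = - f x" if "f \<in> A" for f
    using fun_cong[OF l_neg[of f], of x] that x by (simp add: R_eval eq_neg_iff_add_eq_0)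
  have I: "ideal (fixed_ideal A x) R"
  proof (rule idealI[OF ring_axioms])
    show "subgroup (fixed_ideal A x) (add_monoid R)"
    proof (rule add.subgroupI)
      show "fixed_ideal A x \<subseteq> carrier R"
        by (auto simp: fixed_ideal_def)
      have "\<zero>\<^bsub>R\<^esub> \<in> fixed_ideal A x"
        using zero_closed x by (simp add: fixed_ideal_def R_eval)
      then show "fixed_ideal A x \<noteq> {}" by blast
    next
      fix f assume "f \<in> fixed_ideal A x"
      then show "\<ominus>\<^bsub>R\<^esub> f \<in> fixed_ideal A x"
        using minus a_inv_closed[of f] by (auto simp: fixed_ideal_def)
    next
      fix f g assume "f \<in> fixed_ideal A x" "g \<in> fixed_ideal A x"
      then show "f \<oplus>\<^bsub>R\<^esub> g \<in> fixed_ideal A x"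
        using add.m_closed[of f g] x by (simp add: fixed_ideal_def R_eval)
    qed
  next
    fix f g assume fg: "f \<in> fixed_ideal A x" "g \<in> carrier R"
    then show "g \<otimes>\<^bsub>R\<^esub> f \<in> fixed_ideal A x"
      using m_closed[of g f] x by (simp add: fixed_ideal_def R_eval)
    show "f \<otimes>\<^bsub>R\<^esub> g \<in> fixed_ideal A x"
      using fg m_closed[of f g] x by (simp add: fixed_ideal_def R_eval)
  qed
  have max: "J = fixed_ideal A x \<or> J = carrier R"
    if J: "ideal J R" "fixed_ideal A x \<subseteq> J" for J
  proof (cases "J \<subseteq> fixed_ideal A x")
    case True
    then show ?thesis using J by blast
  next
    case False
    interpret J: ideal J R by fact
    obtain f where f: "f \<in> J" "f \<in> A" "f x \<noteq> 0"
      using False J.a_subset by (auto simp: fixed_ideal_def R_simps(1))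
    \<comment> \<open>Scaling by this constant gives a member of \<open>J\<close> with value 1 at
      \<open>x\<close>. The unit minus it vanishes at \<open>x\<close>, so it lies in
      \<open>fixed_ideal A x\<close>, hence in \<open>J\<close>, and therefore so does the
      unit.\<close>
    define c where "c = (\<lambda>y\<in>topspace X. 1 / f x)"
    have "c \<in> Cc_star X"
      unfolding c_def Cc_star_def Cc_def cont_funs_def
      by (auto simp: bounded_iff intro: countable_subset[of _ "{1 / f x}"])
    then have cA: "c \<in> A" using Cc_star_le by blast
    have cf: "c \<otimes>\<^bsub>R\<^esub> f \<in> J"
      using J.I_l_closed f(1) cA by simp
    then have cfA: "c \<otimes>\<^bsub>R\<^esub> f \<in> A" using J.a_subset R_simps(1) by blast
    have "(c \<otimes>\<^bsub>R\<^esub> f) x = 1"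
      using f(3) x by (simp add: c_def R_eval)
    then have "(\<one>\<^bsub>R\<^esub> \<oplus>\<^bsub>R\<^esub> (\<ominus>\<^bsub>R\<^esub> (c \<otimes>\<^bsub>R\<^esub> f))) x = 0"
      using minus[OF cfA] x unfolding R_simps(5) R_simps(2) by simp
    moreover have "\<one>\<^bsub>R\<^esub> \<oplus>\<^bsub>R\<^esub> (\<ominus>\<^bsub>R\<^esub> (c \<otimes>\<^bsub>R\<^esub> f)) \<in> A"
      using add.m_closed[OF one_closed a_inv_closed[of "c \<otimes>\<^bsub>R\<^esub> f"]] cfA unfolding R_simps(1) by blast
    ultimately have "\<one>\<^bsub>R\<^esub> \<oplus>\<^bsub>R\<^esub> (\<ominus>\<^bsub>R\<^esub> (c \<otimes>\<^bsub>R\<^esub> f)) \<in> J"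
      using J(2) by (auto simp: fixed_ideal_def)
    then have "(\<one>\<^bsub>R\<^esub> \<oplus>\<^bsub>R\<^esub> (\<ominus>\<^bsub>R\<^esub> (c \<otimes>\<^bsub>R\<^esub> f))) \<oplus>\<^bsub>R\<^esub> (c \<otimes>\<^bsub>R\<^esub> f) \<in> J"
      using cf J.a_closed by blast
    moreover have "c \<otimes>\<^bsub>R\<^esub> f \<in> carrier R" using cfA R_simps(1) by simp
    ultimately have "\<one>\<^bsub>R\<^esub> \<in> J"
      by (simp only: a_assoc one_closed a_inv_closed l_neg r_zero)
    then show ?thesis using J.one_imp_carrier by blast
  qed
  have "\<one>\<^bsub>R\<^esub> \<notin> fixed_ideal A x"
    using x by (simp add: fixed_ideal_def R_eval)
  then have "carrier R \<noteq> fixed_ideal A x"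
    using one_closed by blast
  then have "maximalideal (fixed_ideal A x) R"
    using maximalidealI[OF I] max by metis
  then show ?thesis
    by (simp add: max_ideals_def)
qed

text \<open>The trace of \<open>B U\<close> on the image of \<open>X\<close> is the image of
  \<open>U\<close>. This transfers clopen sets between \<open>X\<close> and the structure space in
  all the topological arguments below.\<close>

lemma fixed_ideal_in_B:
  assumes "openin X U" "closedin X U" "x \<in> topspace X"
  shows "fixed_ideal A x \<in> B U \<longleftrightarrow> x \<in> U"
  using assms char_fun_in_A fixed_ideal_in_max_ideals
  by (auto simp: B_def fixed_ideal_def char_fun_def)

lemma closure_of_fixed_ideals:
  "structure_space R closure_of (fixed_ideal A ` topspace X) = topspace (structure_space R)"
proof (rule antisym[OF closure_of_subset_topspace], rule subsetI)
  fix M assume M: "M \<in> topspace (structure_space R)"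
  show "M \<in> structure_space R closure_of (fixed_ideal A ` topspace X)"
    unfolding in_closure_of
  proof (intro conjI allI impI M, elim conjE)
    fix W assume W: "M \<in> W" "openin (structure_space R) W"
    obtain U where U: "openin X U" "closedin X U" "M \<in> B U" "B U \<subseteq> W"
      using B_base[OF W(2,1)] by metis
    \<comment> \<open>Any point of \<open>U\<close> has its fixed ideal in \<open>B U\<close>, so
      density only needs a point; an empty \<open>U\<close> would make \<open>E U\<close> zero,
      which \<open>M\<close> contains.\<close>
    have "U \<noteq> {}"
    proof
      assume "U = {}"
      then have "E U = \<zero>\<^bsub>R\<^esub>" by (simp add: char_fun_def R_eval)
      moreover have "\<zero>\<^bsub>R\<^esub> \<in> M"
        using M topspace_MaxA max_ideal_ideal additive_subgroup.zero_closed ideal.axioms(1)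
        by blast
      ultimately show False using U(3) by (simp add: B_def)
    qed
    then obtain x where "x \<in> U" by blast
    then show "\<exists>N. N \<in> fixed_ideal A ` topspace X \<and> N \<in> W"
      using fixed_ideal_in_B[OF U(1,2)] U(4) openin_subset[OF U(1)] by blast
  qed
qed

lemma continuous_fixed_ideal: "continuous_map X (structure_space R) (fixed_ideal A)"
  unfolding continuous_map topspace_MaxA
proof (intro conjI allI impI)
  show "fixed_ideal A ` topspace X \<subseteq> max_ideals R"
    using fixed_ideal_in_max_ideals by blast
next
  fix W assume W: "openin (structure_space R) W"
  show "openin X {x \<in> topspace X. fixed_ideal A x \<in> W}"
  proof (subst openin_subopen, intro ballI)
    fix x assume x: "x \<in> {x \<in> topspace X. fixed_ideal A x \<in> W}"
    obtain U where U: "openin X U" "closedin X U" "fixed_ideal A x \<in> B U" "B U \<subseteq> W"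
      using B_base[OF W, of "fixed_ideal A x"] x by blast
    then show "\<exists>T. openin X T \<and> x \<in> T \<and> T \<subseteq> {x \<in> topspace X. fixed_ideal A x \<in> W}"
      using fixed_ideal_in_B[OF U(1,2)] x openin_subset[OF U(1)]
      by (intro exI[of _ U]) auto
  qed
qed

text \<open>Clopen sets of \<open>X\<close> separate points, giving injectivity, and form a base,
  giving openness, since the image of a clopen \<open>U\<close> is a trace of
  \<open>B U\<close>.\<close>

lemma embedding_fixed_ideal:
  assumes X: "zero_dimensional_space X" "Hausdorff_space X"
  shows "embedding_map X (structure_space R) (fixed_ideal A)"
  unfolding embedding_map_def
proof (rule bijective_open_imp_homeomorphic_map)
  let ?\<Psi> = "fixed_ideal A" let ?S = "subtopology (structure_space R) (fixed_ideal A ` topspace X)"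
  show "continuous_map X ?S ?\<Psi>"
    using continuous_fixed_ideal by (simp add: continuous_map_in_subtopology)
  show "?\<Psi> ` topspace X = topspace ?S"
    using fixed_ideal_in_max_ideals topspace_MaxA by (auto simp: topspace_subtopology)
  show "inj_on ?\<Psi> (topspace X)"
  proof (rule inj_onI, rule ccontr)
    fix x y assume xy: "x \<in> topspace X" "y \<in> topspace X" "?\<Psi> x = ?\<Psi> y" "x \<noteq> y"
    then obtain V where "openin X V" "x \<in> V" "y \<notin> V"
      using X(2) unfolding Hausdorff_space_def by (meson disjnt_iff)
    then obtain U where U: "openin X U" "closedin X U" "x \<in> U" "y \<notin> U"
      using X(1) unfolding zero_dimensional_space_alt by blast
    then show False
      using fixed_ideal_in_B[OF U(1,2)] xy by metis
  qed
  show "open_map X ?S ?\<Psi>"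
    unfolding open_map_def
  proof (intro allI impI)
    fix V assume V: "openin X V"
    show "openin ?S (?\<Psi> ` V)"
    proof (subst openin_subopen, intro ballI)
      fix M assume "M \<in> ?\<Psi> ` V"
      then obtain x where x: "x \<in> V" "M = ?\<Psi> x" by blast
      obtain U where U: "openin X U" "closedin X U" "x \<in> U" "U \<subseteq> V"
        using X(1) V x(1) unfolding zero_dimensional_space_alt by blast
      have "openin ?S (B U \<inter> ?\<Psi> ` topspace X)"
        using clopen_B(1)[OF U(1,2)] by (rule openin_subtopology_Int)
      moreover have "M \<in> B U \<inter> ?\<Psi> ` topspace X" "B U \<inter> ?\<Psi> ` topspace X \<subseteq> ?\<Psi> ` V"
        using fixed_ideal_in_B[OF U(1,2)] x U(3,4) openin_subset[OF U(1)] by auto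
      ultimately show "\<exists>T. openin ?S T \<and> M \<in> T \<and> T \<subseteq> ?\<Psi> ` V" by blast
    qed
  qed
qed

section \<open>Comparison with zero-dimensional compactifications\<close>

lemma is_compactification_MaxA:
  assumes "zero_dimensional_space X" "Hausdorff_space X"
  shows "is_compactification X (fixed_ideal A, structure_space R)"
  using assms compact_structure_space[OF is_cring] Hausdorff_MaxA embedding_fixed_ideal
    closure_of_fixed_ideals
  by (simp add: is_compactification_def)

text \<open>Serves both the Banaschewski and the Stone-Cech case. A continuous bijection from a
  compact space onto a Hausdorff space is a homeomorphism, so it remains to see that the dominating
  map \<open>t\<close> is bijective.\<close>

lemma compactification_equiv_MaxA:
  assumes c: "is_compactification X c" and zd: "zero_dimensional_space (snd c)"
    and ge: "compactification_ge X c (fixed_ideal A, structure_space R)"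
  shows "compactification_equiv X (fixed_ideal A, structure_space R) c"
proof -
  obtain \<alpha> K where eq: "c = (\<alpha>, K)" by fastforce
  have K: "compact_space K" "Hausdorff_space K" "embedding_map X K \<alpha>"
    and dense: "K closure_of (\<alpha> ` topspace X) = topspace K"
    using c by (auto simp: eq is_compactification_def)
  have \<alpha>: "continuous_map X K \<alpha>"
    using K(3) by (rule embedding_imp_continuous_map)
  obtain t where t: "continuous_map K (structure_space R) t"
    and t\<alpha>: "\<And>x. x \<in> topspace X \<Longrightarrow> t (\<alpha> x) = fixed_ideal A x"
    using ge by (auto simp: eq compactification_ge_def)
  \<comment> \<open>The image of \<open>t\<close> is closed, by compactness of \<open>K\<close>, and
    contains the dense set of fixed ideals.\<close>
  have surj: "t ` topspace K = topspace (structure_space R)"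
  proof
    show "t ` topspace K \<subseteq> topspace (structure_space R)"
      using t by (rule continuous_map_image_subset_topspace)
    have "closedin (structure_space R) (t ` topspace K)"
      using continuous_imp_closed_map[OF t K(1) Hausdorff_MaxA] by (simp add: closed_map_def)
    moreover have "fixed_ideal A ` topspace X \<subseteq> t ` topspace K"
      using t\<alpha> continuous_map_image_subset_topspace[OF \<alpha>] by force
    ultimately show "topspace (structure_space R) \<subseteq> t ` topspace K"
      using closure_of_minimal closure_of_fixed_ideals by metis
  qed
  have "inj_on t (topspace K)"
  proof (rule inj_onI, rule ccontr)
    fix p q assume pq: "p \<in> topspace K" "q \<in> topspace K" "t p = t q" "p \<noteq> q"
    then obtain V where "openin K V" "p \<in> V" "q \<notin> V"
      using K(2) unfolding Hausdorff_space_def by (meson disjnt_iff)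
    then obtain W where W: "openin K W" "closedin K W" "p \<in> W" "q \<notin> W"
      using zd unfolding zero_dimensional_space_alt eq by (metis snd_conv subsetD)
    define U where "U = {x \<in> topspace X. \<alpha> x \<in> W}"
    have U: "openin X U" "closedin X U"
      unfolding U_def using W openin_continuous_map_preimage[OF \<alpha>]
        closedin_continuous_map_preimage[OF \<alpha>] by auto
    \<comment> \<open>A clopen set with the same trace on \<open>X\<close> as \<open>W\<close>, but
      a union of fibres of \<open>t\<close>, so it cannot separate \<open>p\<close> from
      \<open>q\<close>.\<close>
    define T where "T = {z \<in> topspace K. t z \<in> B U}"
    have T: "openin K T" "closedin K T"
      unfolding T_def using openin_continuous_map_preimage[OF t]
        closedin_continuous_map_preimage[OF t] clopen_B[OF U] by auto
    have trace: "\<alpha> x \<in> T \<longleftrightarrow> \<alpha> x \<in> W" if "x \<in> topspace X" for x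
      using that t\<alpha> fixed_ideal_in_B[OF U] continuous_map_image_subset_topspace[OF \<alpha>]
      by (auto simp: T_def U_def)
    \<comment> \<open>The symmetric difference is open and misses the dense image of
      \<open>X\<close>, so it is empty and \<open>T = W\<close>.\<close>
    let ?D = "(W - T) \<union> (T - W)"
    have "openin K ?D"
      using T W by (simp add: openin_diff openin_Un)
    moreover have "?D \<inter> \<alpha> ` topspace X = {}"
      using trace by blast
    ultimately have "?D \<inter> topspace K = {}"
      using openin_Int_closure_of_eq_empty[of K ?D "\<alpha> ` topspace X"] dense by simp
    then have "?D = {}"
      using openin_subset[OF \<open>openin K ?D\<close>] by blast
    then have "p \<in> T" "q \<notin> T" using W by auto
    then show False using pq by (simp add: T_def)
  qed
  then have "homeomorphic_map K (structure_space R) t"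
    using continuous_imp_homeomorphic_map[OF t K(1) Hausdorff_MaxA surj] by blast
  then have "compactification_equiv X c (fixed_ideal A, structure_space R)"
    using t\<alpha> by (auto simp: eq compactification_equiv_def)
  then show ?thesis
    using c by (rule compactification_equiv_sym)
qed

end

theorem theorem2p7:
  fixes X :: "'a topology" and A :: "('a \<Rightarrow> real) set"
  assumes "zero_dimensional_space X" and "Hausdorff_space X"
    and "subring A (cont_ring X)"
    and "Cc_star X \<subseteq> A" and "A \<subseteq> Cc X"
  defines "MaxA \<equiv> structure_space ((cont_ring X)\<lparr>carrier := A\<rparr>)"
  shows "compact_space MaxA \<and> Hausdorff_space MaxA \<and> zero_dimensional_space MaxA \<and>
    is_compactification X (fixed_ideal A, MaxA) \<and>
    compactification_equiv X (fixed_ideal A, MaxA) (banaschewski X) \<and>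
    (strongly_zero_dimensional_space X \<longrightarrow>
       compactification_equiv X (fixed_ideal A, MaxA) (stone_cech X))"
proof -
  interpret Cc_intermediate_ring X A
    using assms(3-5) by (rule Cc_intermediate_ring.intro)
  have c: "is_compactification X (fixed_ideal A, MaxA)"
    unfolding MaxA_def using assms(1,2) by (rule is_compactification_MaxA)
  have zd: "zero_dimensional_space MaxA"
    unfolding MaxA_def by (rule zero_dimensional_MaxA)
  have b: "is_banaschewski X (banaschewski X)"
    using assms(1,2) by (rule is_banaschewski_banaschewski)
  \<comment> \<open>Maximality is defined against compactifications on \<open>'a set set\<close>;
    \<open>is_banaschewski_ge\<close> carries it over to the type of \<open>MaxA\<close>.\<close>
  then have "compactification_ge X (banaschewski X) (fixed_ideal A, MaxA)"
    using is_banaschewski_ge c zd by (metis snd_conv)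
  then have "compactification_equiv X (fixed_ideal A, MaxA) (banaschewski X)"
    using b compactification_equiv_MaxA unfolding MaxA_def is_banaschewski_def by blast
  moreover have "compactification_equiv X (fixed_ideal A, MaxA) (stone_cech X)"
    if "strongly_zero_dimensional_space X"
  proof -
    have "completely_regular_space X"
      using assms(1) zero_dimensional_imp_completely_regular_space
      by (simp add: zero_dimensional_space_iff_dim_le_0)
    then have s: "is_stone_cech X (stone_cech X)"
      using assms(2) by (rule is_stone_cech_stone_cech)
    then have "compactification_ge X (stone_cech X) (fixed_ideal A, MaxA)"
      using is_stone_cech_ge c by blast
    \<comment> \<open>Strong zero-dimensionality supplies the clopen base of \<open>\<beta>X\<close>
      that \<open>compactification_equiv_MaxA\<close> requires.\<close>
    then show ?thesis
      using s that compactification_equiv_MaxA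
      unfolding MaxA_def is_stone_cech_def strongly_zero_dimensional_space_def by blast
  qed
  ultimately show ?thesis
    using c zd by (auto simp: is_compactification_def)
qed

end
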